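(* Fix $j\in\mathbb N$ and write $\phi=\phi_j$, $\lambda=\lambda_j$. Let $0<x\le1$. If $\phi'(x)$ exists, then $$|\phi'(x)|<\frac{(3+\log|\lambda|)\lambda^2}{x^2}.$$
   Context: Let $K:[0,1]\times[0,1]\to\mathbb R$ be defined by $K(x,y)=\frac12-\{(xy)^{-1}\}$ if $0<x,y\le 1$, and $K(x,y)=0$ if $0\le x,y\le1$ and $xy=0$, where $\{\alpha\}=\alpha-\lfloor\alpha\rfloor$. Let $L^2([0,1])$ denote the space of real-valued Lebesgue measurable square-integrable functions on $[0,1]$, with $\langle f,g\rangle=\int_0^1 f(x)g(x)\,dx$ and $\|f\|=\langle f,f\rangle^{1/2}$. A function $\phi$ is an eigenfunction of $K$ (with eigenvalue $\lambda\in\mathbb R$) if $\phi\in L^2([0,1])$, $\|\phi\|>0$, and $\phi(x)=\lambda\int_0^1 K(x,y)\phi(y)\,dy$ for every $x\in[0,1]$. Let $\phi_1,\phi_2,\ldots$ be a maximal orthonormal system in $L^2([0,1])$ of eigenfunctions of $K$, $\phi_j$ having the nonzero real eigenvalue $\lambda_j$, numbered so that $0<|\lambda_1|\le|\lambda_2|\le\cdots$ and $\lambda_j\ge\lambda_{j+1}$ whenever $|\lambda_j|=|\lambda_{j+1}|$. At $x=1$, $\phi'(1)$ means the left-hand derivative (the domain of $\phi$ being $[0,1]$). *)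

theory Defs
  imports "HOL-Analysis.Analysis"
begin

text \<open>The kernel K(x,y) = 1/2 - {1/(xy)} for 0 < x,y, and 0 when xy = 0
  (only its values on [0,1] x [0,1] are ever used).\<close>
definition K :: "real \<Rightarrow> real \<Rightarrow> real" where
  "K x y = (if x * y = 0 then 0 else 1/2 - frac (1 / (x * y)))"

definition L2_01 :: "(real \<Rightarrow> real) set" where
  "L2_01 = {f. set_borel_measurable lebesgue {0..1} f \<and>
                set_integrable lebesgue {0..1} (\<lambda>x. (f x)\<^sup>2)}"

definition inner01 :: "(real \<Rightarrow> real) \<Rightarrow> (real \<Rightarrow> real) \<Rightarrow> real" where
  "inner01 f g = (LINT x:{0..1}|lebesgue. f x * g x)"

definition norm01 :: "(real \<Rightarrow> real) \<Rightarrow> real" where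
  "norm01 f = sqrt (inner01 f f)"

definition is_eigenfunction :: "(real \<Rightarrow> real) \<Rightarrow> real \<Rightarrow> bool" where
  "is_eigenfunction phi lam \<longleftrightarrow>
     phi \<in> L2_01 \<and> norm01 phi > 0 \<and>
     (\<forall>x\<in>{0..1}. phi x = lam * (LINT y:{0..1}|lebesgue. K x y * phi y))"

definition max_orthonormal_eigensystem ::
  "nat set \<Rightarrow> (nat \<Rightarrow> real \<Rightarrow> real) \<Rightarrow> (nat \<Rightarrow> real) \<Rightarrow> bool" where
  "max_orthonormal_eigensystem J phi lam \<longleftrightarrow>
     (J = {1..} \<or> (\<exists>n. J = {1..n})) \<and>
     (\<forall>j\<in>J. lam j \<noteq> 0 \<and> is_eigenfunction (phi j) (lam j)) \<and>
     (\<forall>i\<in>J. \<forall>j\<in>J. inner01 (phi i) (phi j) = (if i = j then 1 else 0)) \<and>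
     (\<forall>psi mu. is_eigenfunction psi mu \<longrightarrow> \<not> (\<forall>j\<in>J. inner01 psi (phi j) = 0))"

definition eigen_ordered :: "nat set \<Rightarrow> (nat \<Rightarrow> real) \<Rightarrow> bool" where
  "eigen_ordered J lam \<longleftrightarrow>
     (\<forall>i\<in>J. \<forall>j\<in>J. i \<le> j \<longrightarrow> \<bar>lam i\<bar> \<le> \<bar>lam j\<bar>) \<and>
     (\<forall>j. j \<in> J \<and> Suc j \<in> J \<and> \<bar>lam j\<bar> = \<bar>lam (Suc j)\<bar> \<longrightarrow> lam j \<ge> lam (Suc j))"

end

theory Submission
  imports Defs
begin

text \<open>
  Write \<open>a = 1/x\<close>. For \<open>x' < x\<close> and \<open>a' = 1/x'\<close> one has \<open>K x y - K x' y = (a' - a)/y - N y\<close>, where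
  \<open>N y\<close> counts the \<open>n\<close> with \<open>a/n < y \<le> a'/n\<close>. Hence \<open>\<bar>\<phi> x - \<phi> x'\<bar> / (a' - a)\<close> is bounded by
  \<open>\<bar>\<lambda>\<bar>\<close> times \<open>\<integral> \<bar>\<phi> y\<bar>/y dy + \<Sum>\<^bsub>n>a\<^esub> sup \<bar>\<phi>\<bar> / n\<close>, the supremum being over \<open>y \<le> a'/n\<close>.
  Two bounds on \<open>\<phi>\<close> make this converge: \<open>\<bar>\<phi>\<bar> \<le> \<bar>\<lambda>\<bar>/2\<close>, from \<open>\<bar>K\<bar> \<le> 1/2\<close>, and
  \<open>\<bar>\<phi> y\<bar> \<le> C \<lambda>\<^sup>2 \<surd>y\<close>, from the oscillation of \<open>K\<close>: integration by parts shows that the iterated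
  kernel \<open>K\<^sub>2 x z = \<integral> K x y K y z dy\<close> is at most \<open>min (1/4) (x/(4z))\<close> in absolute value, so
  that \<open>\<parallel>K\<^sub>2 x\<parallel>\<^sup>2 \<le> x/8\<close>. They balance at \<open>y\<close> of order \<open>1/\<lambda>\<^sup>2\<close>, so the sum contributes
  \<open>\<bar>\<lambda>\<bar>/2 (ln (\<lambda>\<^sup>2) + O(1))\<close>; in the integral, \<open>\<parallel>\<phi>\<parallel> = 1\<close> and the Cauchy-Schwarz inequality
  on \<open>y \<ge> 1/\<lambda>\<^sup>2\<close> avoid a logarithm altogether. Only left difference quotients are used, so
  points with \<open>1/x\<close> an integer need no separate treatment.
\<close>

section \<open>The iterated kernel\<close>

text \<open>The constant is the one that minimises the supremum norm.\<close>

definition saw_primitive :: "real \<Rightarrow> real" where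
  "saw_primitive t = frac t * (1 - frac t) / 2 - 1/16"

lemma abs_saw_primitive_le: "\<bar>saw_primitive t\<bar> \<le> 1/16"
proof -
  have "0 \<le> frac t * (1 - frac t)"
    using frac_lt_1[of t] by simp
  moreover have "frac t * (1 - frac t) \<le> 1/4"
    using zero_le_power2[of "frac t - 1/2"] by (simp add: power2_eq_square algebra_simps)
  ultimately show ?thesis
    unfolding saw_primitive_def by linarith
qed

lemma frac_has_real_derivative:
  fixes t :: real
  assumes "t \<notin> \<int>"
  shows "(frac has_real_derivative 1) (at t)"
proof -
  have "((\<lambda>x. real_of_int \<lfloor>x\<rfloor>) has_real_derivative 0) (at t)"
    using floor_has_real_derivative[of t "\<lambda>x. x"] assms by simp
  from DERIV_diff[OF DERIV_ident this] show ?thesis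
    by (simp add: frac_def[abs_def])
qed

lemma saw_primitive_has_real_derivative:
  assumes "t \<notin> \<int>"
  shows "(saw_primitive has_real_derivative (1/2 - frac t)) (at t)"
  unfolding saw_primitive_def[abs_def]
  by (rule derivative_eq_intros frac_has_real_derivative[OF assms] refl | simp)+

text \<open>\<open>frac\<close> jumps at an integer, but \<open>frac s * (1 - frac s)\<close> tends
  to 0 from both sides: its first factor is small on the right, its second on the left. This gives
  continuity at the points where the derivative formula fails.\<close>

lemma saw_primitive_near_Ints:
  fixes s t :: real
  assumes "t \<in> \<int>" and "\<bar>s - t\<bar> < 1"
  shows "\<bar>saw_primitive s - saw_primitive t\<bar> \<le> \<bar>s - t\<bar>"
proof -
  obtain n where n: "t = of_int n" using assms(1) by (auto elim: Ints_cases)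
  have "frac s * (1 - frac s) \<le> \<bar>s - t\<bar>"
  proof (cases "s \<ge> t")
    case True
    then have "\<lfloor>s\<rfloor> = n" using assms n by (intro floor_unique) auto
    then have "frac s = s - t" by (simp add: frac_def n)
    then show ?thesis using True by (simp add: mult_left_le)
  next
    case False
    then have "\<lfloor>s\<rfloor> = n - 1" using assms n by (intro floor_unique) auto
    then have f: "1 - frac s = t - s" by (simp add: frac_def n)
    have "frac s * (1 - frac s) \<le> 1 * (1 - frac s)"
      using frac_lt_1[of s] by (intro mult_right_mono) auto
    then show ?thesis using f False by simp
  qed
  moreover have "0 \<le> frac s * (1 - frac s)" using frac_lt_1[of s] by simp
  ultimately show ?thesis
    using n by (simp add: saw_primitive_def)
qed

lemma continuous_on_saw_primitive: "continuous_on A saw_primitive"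
proof (intro continuous_at_imp_continuous_on ballI)
  fix t :: real
  show "isCont saw_primitive t"
  proof (cases "t \<in> \<int>")
    case False
    then show ?thesis by (rule DERIV_isCont[OF saw_primitive_has_real_derivative])
  next
    case True
    have ev: "\<forall>\<^sub>F s in at t. norm (saw_primitive s - saw_primitive t) \<le> \<bar>s - t\<bar>"
      unfolding eventually_at
      by (rule exI[of _ 1]) (auto simp: dist_real_def saw_primitive_near_Ints[OF True])
    have "((\<lambda>s. \<bar>s - t\<bar>) \<longlongrightarrow> 0) (at t)"
      by (auto intro!: tendsto_eq_intros)
    from Lim_null_comparison[OF ev this] show ?thesis
      by (simp add: isCont_def LIM_zero_iff)
  qed
qed

text \<open>Integration by parts. On this cell the floor of \<open>b/y\<close> is \<open>n\<close>,
  so one factor is smooth; the other is the derivative of \<open>saw_primitive (a/y)\<close> up to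
  the factor \<open>-a/y\<^sup>2\<close>, and this is where the gain \<open>1/a\<close> comes
  from.\<close>

lemma saw_integral_cell_bound:
  fixes a b p q :: real and n :: int
  assumes "a > 0" "b > 0" "0 < p" "p \<le> q"
    and n: "of_int n \<le> b / q" "b / p \<le> of_int n + 1"
    and int: "(\<lambda>y. (1/2 - frac (a/y)) * (1/2 - frac (b/y))) integrable_on {p..q}"
  shows "\<bar>integral {p..q} (\<lambda>y. (1/2 - frac (a/y)) * (1/2 - frac (b/y)))\<bar> \<le> (q\<^sup>2 + b * (q - p)) / (16 * a)"
proof -
  define r where "r y = of_int n + 1/2 - b/y" for y
  \<comment> \<open>\<open>F\<close> is the boundary term and \<open>E\<close> the integrand left
    over: \<open>F' = f - E\<close>, since \<open>y\<^sup>2 * r y\<close> has derivative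
    \<open>2 * y * r y + b\<close>.\<close>
  define F where "F y = - (1/a) * saw_primitive (a/y) * (y\<^sup>2 * r y)" for y
  define E where "E y = (1/a) * saw_primitive (a/y) * (2 * y * r y + b)" for y
  define f where "f = (\<lambda>y. (1/2 - frac (a/y)) * (1/2 - frac (b/y)))"
  have r_eq: "1/2 - frac (b/y) = r y" if y: "y \<in> {p<..<q}" for y
  proof -
    have "b / q \<le> b / y" "b / y < b / p"
      using y assms by (auto intro!: divide_left_mono divide_strict_left_mono mult_pos_pos)
    then have "\<lfloor>b/y\<rfloor> = n" using n by (intro floor_unique) auto
    then show ?thesis by (simp add: frac_def r_def)
  qed
  have r_bd: "\<bar>r y\<bar> \<le> 1/2" if y: "y \<in> {p..q}" for y
  proof -
    have "b / q \<le> b / y" "b / y \<le> b / p"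
      using y assms by (auto intro!: divide_left_mono mult_pos_pos)
    then show ?thesis using n unfolding r_def by linarith
  qed
  \<comment> \<open>The kinks of \<open>saw_primitive (a/y)\<close> in the cell. There are finitely
    many and \<open>F\<close> is continuous across them, so the fundamental theorem still
    applies.\<close>
  define S where "S = (\<lambda>k::int. a / of_int k) ` {\<lfloor>a/q\<rfloor>..\<lceil>a/p\<rceil>}"
  have S: "a / y \<notin> \<int>" if y: "y \<in> {p<..<q} - S" for y
  proof
    assume "a / y \<in> \<int>"
    then obtain k where k: "a / y = of_int k" by (auto elim: Ints_cases)
    have "a / q \<le> a / y" "a / y \<le> a / p"
      using y assms by (auto intro!: divide_left_mono mult_pos_pos)
    then have "k \<in> {\<lfloor>a/q\<rfloor>..\<lceil>a/p\<rceil>}" using k by (auto; linarith)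
    moreover have "y = a / of_int k" using k[symmetric] assms(1) by simp
    ultimately show False using y by (auto simp: S_def)
  qed
  have cont_saw: "continuous_on {p..q} (\<lambda>y. saw_primitive (a/y))"
    using assms by (intro continuous_on_compose2[OF continuous_on_saw_primitive[of UNIV]] continuous_intros) auto
  have cont_r: "continuous_on {p..q} r"
    unfolding r_def using assms by (intro continuous_intros) auto
  have FTC: "((\<lambda>y. f y - E y) has_integral (F q - F p)) {p..q}"
  proof (rule fundamental_theorem_of_calculus_interior_strong[of S])
    show "finite S" by (simp add: S_def)
    show "continuous_on {p..q} F" unfolding F_def
      by (intro continuous_intros cont_saw cont_r)
    fix y assume y: "y \<in> {p<..<q} - S"
    then have y0: "y > 0" using assms by auto
    have d1: "((\<lambda>y. saw_primitive (a/y)) has_real_derivative (1/2 - frac (a/y)) * (- a / y\<^sup>2)) (at y)"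
      by (rule DERIV_chain2[where f = saw_primitive and g = "\<lambda>y. a/y", OF saw_primitive_has_real_derivative[OF S[OF y]]])
         (use y0 in \<open>auto intro!: derivative_eq_intros simp: power2_eq_square\<close>)
    have d2: "((\<lambda>y. y\<^sup>2 * r y) has_real_derivative 2 * y * r y + b) (at y)"
      unfolding r_def using y0 by (auto intro!: derivative_eq_intros simp: power2_eq_square)
    have "(F has_real_derivative (- (1/a) * ((1/2 - frac (a/y)) * (- a / y\<^sup>2)) * (y\<^sup>2 * r y) - E y)) (at y)"
      unfolding F_def[abs_def] E_def
      by (rule derivative_eq_intros d1 d2 refl)+ (simp add: algebra_simps)
    also have "- (1/a) * ((1/2 - frac (a/y)) * (- a / y\<^sup>2)) * (y\<^sup>2 * r y) = (1/2 - frac (a/y)) * r y"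
      using y0 assms(1) by (simp add: algebra_simps)
    also have "\<dots> = f y"
      using r_eq[of y] y by (simp add: f_def)
    finally show "(F has_vector_derivative f y - E y) (at y)"
      by (simp add: has_real_derivative_iff_has_vector_derivative)
  qed fact
  have intE: "E integrable_on {p..q}"
    unfolding E_def by (intro integrable_continuous_real continuous_intros cont_saw cont_r)
  have eq: "integral {p..q} f = (F q - F p) + integral {p..q} E"
    using has_integral_add[OF FTC integrable_integral[OF intE]] by (simp add: integral_unique)
  have Fb: "\<bar>F y\<bar> \<le> y\<^sup>2 / (32 * a)" if y: "y \<in> {p..q}" for y
  proof -
    have "\<bar>F y\<bar> = (1/a) * (\<bar>saw_primitive (a/y)\<bar> * (y\<^sup>2 * \<bar>r y\<bar>))"
      using assms by (simp add: F_def abs_mult)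
    also have "\<dots> \<le> (1/a) * ((1/16) * (y\<^sup>2 * (1/2)))"
      using assms r_bd[OF y] abs_saw_primitive_le[of "a/y"]
      by (intro mult_left_mono mult_mono) auto
    finally show ?thesis by simp
  qed
  have Eb: "norm (E y) \<le> (y + b) / (16 * a)" if y: "y \<in> {p..q}" for y
  proof -
    have "\<bar>2 * y * r y + b\<bar> \<le> 2 * y * \<bar>r y\<bar> + b"
      using y assms by (intro order_trans[OF abs_triangle_ineq]) (simp add: abs_mult)
    also have "\<dots> \<le> y + b"
      using mult_left_mono[OF r_bd[OF y], of "2*y"] y assms by simp
    finally have h: "\<bar>2 * y * r y + b\<bar> \<le> y + b" .
    have "\<bar>E y\<bar> = (1/a) * (\<bar>saw_primitive (a/y)\<bar> * \<bar>2 * y * r y + b\<bar>)"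
      using assms by (simp add: E_def abs_mult)
    also have "\<dots> \<le> (1/a) * ((1/16) * (y + b))"
      using assms h abs_saw_primitive_le[of "a/y"]
      by (intro mult_left_mono mult_mono) auto
    finally show ?thesis by simp
  qed
  have "((\<lambda>y. (y + b) / (16*a)) has_integral ((q\<^sup>2/2 + b*q)/(16*a) - (p\<^sup>2/2+b*p)/(16*a))) {p..q}"
    by (rule fundamental_theorem_of_calculus)
       (use assms in \<open>auto intro!: derivative_eq_intros simp: has_real_derivative_iff_has_vector_derivative[symmetric] field_simps\<close>)
  then have "norm (integral {p..q} E) \<le> (q\<^sup>2/2 + b*q)/(16*a) - (p\<^sup>2/2+b*p)/(16*a)"
    using integral_norm_bound_integral[OF intE _ Eb] by (metis has_integral_integrable_integral)
  moreover have "\<bar>F q\<bar> \<le> q\<^sup>2 / (32 * a)" "\<bar>F p\<bar> \<le> p\<^sup>2 / (32 * a)"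
    using Fb assms by auto
  ultimately have "\<bar>integral {p..q} f\<bar> \<le> q\<^sup>2 / (32 * a) + p\<^sup>2 / (32 * a) + ((q\<^sup>2/2 + b*q)/(16*a) - (p\<^sup>2/2+b*p)/(16*a))"
    unfolding eq by (simp add: abs_le_iff)
  \<comment> \<open>The boundary term at \<open>p\<close> cancels against the lower limit of the
    integral of \<open>y\<close>.\<close>
  also have "\<dots> = (q\<^sup>2 + b * (q - p)) / (16 * a)"
    using assms by (simp add: field_simps)
  finally show ?thesis unfolding f_def .
qed

section \<open>Integration over the unit interval and elementary kernel bounds\<close>

abbreviation unit_measure :: "real measure" where
  "unit_measure \<equiv> lebesgue_on {0..1}"

lemma finite_unit_measure: "finite_measure unit_measure"
  by (rule finite_measure_lebesgue_on) auto

lemma measure_unit_measure: "measure unit_measure {0..1} = 1"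
  by (simp add: measure_restrict_space)

lemma set_integral_unit: "(LINT y:{0..1}|lebesgue. f y) = (LINT y|unit_measure. f y)" for f :: "real \<Rightarrow> real"
  by (simp add: set_lebesgue_integral_def integral_restrict_space)

lemma abs_K_le: "\<bar>K x y\<bar> \<le> 1/2"
proof -
  have "\<bar>1/2 - frac (1/(x*y))\<bar> \<le> 1/2"
    using frac_ge_0[of "1/(x*y)"] frac_lt_1[of "1/(x*y)"] by linarith
  then show ?thesis by (auto simp: K_def)
qed

lemma borel_measurable_K [measurable]:
  assumes [measurable]: "f \<in> borel_measurable M" "g \<in> borel_measurable M"
  shows "(\<lambda>w. K (f w) (g w)) \<in> borel_measurable M"
  unfolding K_def frac_def by measurable

lemma ident_measurable_unit [measurable]: "(\<lambda>y. y) \<in> borel_measurable unit_measure"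
  using id_borel_measurable_lebesgue_on[of "{0..1}"] by (simp add: id_def)

lemma integrable_unit_bounded:
  fixes f :: "real \<Rightarrow> real"
  assumes "f \<in> borel_measurable unit_measure" "\<And>y. y \<in> {0..1} \<Longrightarrow> \<bar>f y\<bar> \<le> B"
  shows "integrable unit_measure f"
  by (rule finite_measure.integrable_const_bound[OF finite_unit_measure, of _ B])
     (use assms in \<open>auto intro!: AE_I2\<close>)

text \<open>A non-integrable function has integral 0 by convention, so the estimate can be applied
  without proving integrability first.\<close>

lemma abs_integral_unit_le:
  fixes f :: "real \<Rightarrow> real"
  assumes "\<And>y. y \<in> {0..1} \<Longrightarrow> \<bar>f y\<bar> \<le> B" "0 \<le> B"
  shows "\<bar>LINT y|unit_measure. f y\<bar> \<le> B"
proof (cases "integrable unit_measure f")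
  case True
  have "\<bar>LINT y|unit_measure. f y\<bar> \<le> (LINT y|unit_measure. B)"
    by (rule integral_abs_bound_integral)
       (use assms True in \<open>auto simp: finite_measure.integrable_const[OF finite_unit_measure]\<close>)
  then show ?thesis by (simp add: measure_unit_measure)
qed (simp add: not_integrable_integral_eq assms)

lemma KK_bounded: "\<bar>K x y * K y' z\<bar> \<le> 1/4"
proof -
  have "\<bar>K x y * K y' z\<bar> \<le> (1/2) * (1/2)"
    unfolding abs_mult by (intro mult_mono abs_K_le) auto
  then show ?thesis by simp
qed

lemma integrable_KK: "integrable unit_measure (\<lambda>y. K x y * K y z)"
  by (rule integrable_unit_bounded[of _ "1/4"]) (measurable, use KK_bounded in auto)

text \<open>The points \<open>b/n\<close> cut the interval into cells on which the floor of
  \<open>b/y\<close> is constant; the first cell \<open>[b/m, 1]\<close> is truncated at 1. Summing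
  the cell bounds, the lengths telescope exactly and the squares telescope through
  \<open>1/N\<^sup>2 \<le> 1/(N - 1) - 1/N\<close>.\<close>

lemma integral_KK_tail_bound:
  fixes a b :: real and N m :: nat
  defines "f \<equiv> \<lambda>y. (1/2 - frac (a/y)) * (1/2 - frac (b/y))"
  assumes "a > 0" "b \<ge> 1" and m: "m = nat \<lfloor>b\<rfloor> + 1"
    and int: "f integrable_on {0..1}" and "m \<le> N"
  shows "\<bar>integral {b / N..1} f\<bar> \<le>
    (1 + b * (1 - b / N) + b\<^sup>2 * (1 / (real m - 1) - 1 / (real N - 1))) / (16 * a)"
  using \<open>m \<le> N\<close>
proof (induction N rule: dec_induct)
  case base
  have mb: "real m - 1 \<le> b" "b < real m" "m \<ge> 2"
    using assms(3) unfolding m by (auto simp: le_nat_iff) linarith+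
  have "\<bar>integral {b / m..1} f\<bar> \<le> (1\<^sup>2 + b * (1 - b / m)) / (16 * a)"
    unfolding f_def
  proof (rule saw_integral_cell_bound[where n = "int m - 1"])
    show "(\<lambda>y. (1 / 2 - frac (a / y)) * (1 / 2 - frac (b / y))) integrable_on {b / real m..1}"
      using int unfolding f_def
      by (rule integrable_on_subinterval) (subst atLeastatMost_subset_iff, use assms(3) in simp)
  qed (use mb assms in auto)
  then show ?case by simp
next
  case (step N)
  have mb: "real m - 1 \<le> b" "b < real m" "m \<ge> 2"
    using assms(3) unfolding m by (auto simp: le_nat_iff) linarith+
  have N: "N \<ge> 2" "b < N" using mb step by linarith+
  have b0: "b > 0" using assms(3) by simp
  have le: "b / Suc N \<le> b / N" using N b0 by (intro divide_left_mono) auto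
  have "\<bar>integral {b / Suc N..b / N} f\<bar> \<le> ((b/N)\<^sup>2 + b * (b / N - b / Suc N)) / (16 * a)"
    unfolding f_def
  proof (rule saw_integral_cell_bound[where n = "int N"])
    show "(\<lambda>y. (1 / 2 - frac (a / y)) * (1 / 2 - frac (b / y))) integrable_on {b / Suc N..b / N}"
      using int unfolding f_def
      by (rule integrable_on_subinterval) (subst atLeastatMost_subset_iff, use N b0 in simp)
  qed (use le N b0 assms in auto)
  also have "\<dots> \<le> (b\<^sup>2 * (1 / (real N - 1) - 1 / N) + b * (b / N - b / Suc N)) / (16 * a)"
  proof (intro divide_right_mono add_right_mono)
    have "(1 / real N)\<^sup>2 \<le> 1 / (real N - 1) - 1 / N"
      using N by (simp add: field_simps power2_eq_square)
    then have "b\<^sup>2 * (1 / real N)\<^sup>2 \<le> b\<^sup>2 * (1 / (real N - 1) - 1 / N)"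
      by (intro mult_left_mono) auto
    then show "(b/N)\<^sup>2 \<le> b\<^sup>2 * (1 / (real N - 1) - 1 / N)"
      by (simp add: power_divide)
  qed (use assms in auto)
  finally have 1: "\<bar>integral {b / Suc N..b / N} f\<bar> \<le> (b\<^sup>2 * (1 / (real N - 1) - 1 / N) + b * (b / N - b / Suc N)) / (16 * a)" .
  have "integral {b / Suc N..b / N} f + integral {b / N..1} f = integral {b / Suc N..1} f"
  proof (rule Henstock_Kurzweil_Integration.integral_combine)
    show "f integrable_on {b / Suc N..1}"
      using int
      by (rule integrable_on_subinterval) (subst atLeastatMost_subset_iff, use b0 in simp)
  qed (use le N in auto)
  then have "\<bar>integral {b / Suc N..1} f\<bar> \<le> \<bar>integral {b / Suc N..b / N} f\<bar> + \<bar>integral {b / N..1} f\<bar>"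
    by linarith
  also have "\<dots> \<le> (b\<^sup>2 * (1 / (real N - 1) - 1 / N) + b * (b / N - b / Suc N)) / (16 * a)
      + (1 + b * (1 - b / N) + b\<^sup>2 * (1 / (real m - 1) - 1 / (real N - 1))) / (16 * a)"
    by (intro add_mono 1 step.IH)
  also have "\<dots> = (1 + b * (1 - b / Suc N) + b\<^sup>2 * (1 / (real m - 1) - 1 / N)) / (16 * a)"
    unfolding add_divide_distrib[symmetric] by (simp add: algebra_simps)
  finally show ?case by simp
qed

text \<open>The tail bound with \<open>a = 1/x\<close> and \<open>b = 1/z\<close>, in the limit of
  infinitely many cells; \<open>b / (4 * a)\<close> is the claimed value.\<close>

lemma abs_integral_KK_le:
  assumes x: "0 < x" "x \<le> 1" and z: "0 < z" "z \<le> 1"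
  shows "\<bar>LINT y|unit_measure. K x y * K y z\<bar> \<le> x / (4 * z)"
proof -
  define a where "a = 1 / x"
  define b where "b = 1 / z"
  have ab: "a \<ge> 1" "b \<ge> 1" using assms by (auto simp: a_def b_def)
  define f where "f = (\<lambda>y. (1/2 - frac (a/y)) * (1/2 - frac (b/y)))"
  have eq: "f y = K x y * K y z" if "y \<noteq> 0" for y
    using that assms by (simp add: f_def K_def a_def b_def mult.commute)
  have intKK: "((\<lambda>y. K x y * K y z) has_integral (LINT y|unit_measure. K x y * K y z)) {0..1}"
    by (rule has_integral_integral_lebesgue_on[OF integrable_KK]) auto
  \<comment> \<open>At \<open>y = 0\<close> the kernel is 0 but \<open>f\<close> is 1/4, because
    division by zero yields 0; one point does not affect the integral.\<close>
  then have hf: "(f has_integral (LINT y|unit_measure. K x y * K y z)) {0..1}"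
    by (rule has_integral_spike[of "{0}", rotated 2]) (auto simp: eq)
  then have int: "f integrable_on {0..1}" by blast
  have fb: "norm (f y) \<le> 1/4" for y
  proof -
    have "\<bar>1/2 - frac (a/y)\<bar> \<le> 1/2" "\<bar>1/2 - frac (b/y)\<bar> \<le> 1/2"
      using frac_ge_0[of "a/y"] frac_lt_1[of "a/y"] frac_ge_0[of "b/y"] frac_lt_1[of "b/y"] by linarith+
    then have "\<bar>f y\<bar> \<le> (1/2) * (1/2)" unfolding f_def abs_mult by (intro mult_mono) auto
    then show ?thesis by simp
  qed
  define m where "m = nat \<lfloor>b\<rfloor> + 1"
  have mb: "real m - 1 \<le> b" "b < real m" "m \<ge> 2"
    using ab unfolding m_def by (auto simp: le_nat_iff) linarith+
  have key: "\<bar>integral {0..1} f\<bar> \<le> b / 4 / N + b / (4 * a)" if "N \<ge> m" for N :: nat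
  proof -
    have N: "b < N" "real N - 1 > 0" "b / N \<le> 1" "0 \<le> b / N" using that mb ab by auto
    have "\<bar>integral {b / N..1} f\<bar> \<le>
      (1 + b * (1 - b / N) + b\<^sup>2 * (1 / (real m - 1) - 1 / (real N - 1))) / (16 * a)"
      using integral_KK_tail_bound[of a b m N] int ab that m_def unfolding f_def by simp
    \<comment> \<open>The three summands are at most \<open>b\<close>, \<open>b\<close> and
      \<open>2 * b\<close>; the last because \<open>b < m \<le> 2 * (m - 1)\<close>.\<close>
    also have "\<dots> \<le> (4 * b) / (16 * a)"
    proof (rule divide_right_mono)
      have "b * (1 - b / N) \<le> b * 1" using N ab by (intro mult_left_mono) auto
      moreover have "b\<^sup>2 * (1 / (real m - 1) - 1 / (real N - 1)) \<le> b\<^sup>2 * (1 / (real m - 1))"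
        using N by (intro mult_left_mono) auto
      moreover have "b\<^sup>2 * (1 / (real m - 1)) \<le> 2 * b"
      proof -
        have "real m \<ge> 2" using mb(3) by simp
        then have "b \<le> 2 * (real m - 1)" using mb(2) by argo
        then have "b * b \<le> b * (2 * (real m - 1))" using ab by (intro mult_left_mono) auto
        then show ?thesis using mb by (simp add: field_simps power2_eq_square)
      qed
      ultimately show "1 + b * (1 - b / N) + b\<^sup>2 * (1 / (real m - 1) - 1 / (real N - 1)) \<le> 4 * b"
        using ab by linarith
    qed (use ab in auto)
    finally have 1: "\<bar>integral {b / N..1} f\<bar> \<le> b / (4 * a)" by simp
    have "norm (integral {0..b / N} f) \<le> integral {0..b/N} (\<lambda>y. 1/4)"
    proof (rule integral_norm_bound_integral)
      show "f integrable_on {0..b / N}"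
        using int
        by (rule integrable_on_subinterval) (subst atLeastatMost_subset_iff, use N in simp)
    qed (use fb in auto)
    then have 2: "\<bar>integral {0..b / N} f\<bar> \<le> b / 4 / N" using N by simp
    have "integral {0..b / N} f + integral {b / N..1} f = integral {0..1} f"
      by (rule Henstock_Kurzweil_Integration.integral_combine) (use N int in auto)
    then show ?thesis using 1 2 by linarith
  qed
  have "\<bar>integral {0..1} f\<bar> \<le> 0 + b / (4 * a)"
  proof (rule tendsto_lowerbound)
    show "(\<lambda>N. b / 4 / real N + b / (4 * a)) \<longlonglongrightarrow> 0 + b / (4 * a)"
      by (intro tendsto_add tendsto_const lim_const_over_n)
    show "\<forall>\<^sub>F N in sequentially. \<bar>integral {0..1} f\<bar> \<le> b / 4 / real N + b / (4 * a)"
      using key eventually_at_top_linorder by blast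
  qed simp
  then show ?thesis
    using integral_unique[OF hf] by (simp add: a_def b_def)
qed

section \<open>A harmonic sum with a cutoff\<close>

text \<open>A primitive of the decreasing function \<open>min 1 (sqrt (T / t)) / t\<close>.\<close>

definition tail_majorant :: "real \<Rightarrow> real \<Rightarrow> real" where
  "tail_majorant T t = (if t \<le> T then ln t else ln T + 2 - 2 * sqrt (T / t))"

lemma one_minus_inverse_le_ln: "0 < (u::real) \<Longrightarrow> 1 - 1 / u \<le> ln u"
  using ln_le_minus_one[of "1/u"] by (simp add: ln_div)

text \<open>The left side is the value at \<open>n\<close> of the decreasing function whose
  primitive is \<open>tail_majorant T\<close>, hence at most its integral over
  \<open>[n - 1, n]\<close>. The cases place this interval before \<open>T\<close>, after
  \<open>T\<close>, or across it.\<close>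

lemma tail_majorant_step:
  fixes T :: real and n :: nat
  assumes T: "T > 0" and n: "n \<ge> 2"
  shows "min 1 (sqrt (T / n)) / n \<le> tail_majorant T n - tail_majorant T (real n - 1)"
proof -
  have n1: "real n - 1 > 0" "real n > 0" using n by auto
  consider "real n \<le> T" | "T \<le> real n - 1" | "real n - 1 < T" "T < real n" by linarith
  then show ?thesis
  proof cases
    case 1
    have "min 1 (sqrt (T / n)) / n \<le> 1 / n" by (intro divide_right_mono) auto
    also have "\<dots> = 1 - 1 / (real n / (real n - 1))" using n1 by (simp add: field_simps)
    also have "\<dots> \<le> ln (real n / (real n - 1))" using n1 by (intro one_minus_inverse_le_ln) auto
    also have "\<dots> = ln n - ln (real n - 1)" using n1 by (simp add: ln_div)
    finally show ?thesis using 1 by (simp add: tail_majorant_def)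
  next
    case 2
    define p q s where "p = sqrt (real n - 1)" and "q = sqrt n" and "s = sqrt T"
    have pqs: "p > 0" "q > 0" "s > 0" "p \<le> q" using n1 T by (auto simp: p_def q_def s_def)
    have q2: "q\<^sup>2 = real n" and p2: "p\<^sup>2 = real n - 1" using n1 by (auto simp: p_def q_def)
    \<comment> \<open>Since \<open>(q - p) * (q + p) = 1\<close>, the increment
      \<open>2 * (s/p - s/q)\<close> equals \<open>2 * s / (p * q * (q + p))\<close>, which this
      inequality compares with \<open>s / q^3\<close>.\<close>
    have "p * (q + p) \<le> 2 * (q * q)"
      using mult_mono[of p q "q + p" "2 * q"] pqs by (simp add: mult_ac)
    then have "2 / (2 * (q * q)) \<le> 2 / (p * (q + p))"
      using pqs by (intro divide_left_mono) auto
    then have "1 / (q * q) \<le> 2 / (p * (q + p))" by simp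
    then have "(s / q) * (1 / (q * q)) \<le> (s / q) * (2 / (p * (q + p)))"
      using pqs by (intro mult_left_mono) auto
    also have "(s / q) * (2 / (p * (q + p))) = 2 * (s / p - s / q)"
    proof -
      have "(q - p) * (q + p) = 1" using q2 p2 by (simp add: algebra_simps power2_eq_square)
      then have "1 / (q + p) = q - p" using pqs by (simp add: field_simps)
      then have "(s / q) * (2 / (p * (q + p))) = 2 * s / (q * p) * (q - p)"
        by (metis (no_types, opaque_lifting) mult.commute mult.right_neutral times_divide_eq_left times_divide_eq_right divide_divide_eq_left' divide_divide_eq_left)
      also have "\<dots> = 2 * (s / p - s / q)" using pqs by (simp add: field_simps)
      finally show ?thesis .
    qed
    finally have *: "sqrt (T / n) / n \<le> 2 * (sqrt (T / (real n - 1)) - sqrt (T / n))"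
      unfolding real_sqrt_divide p_def[symmetric] q_def[symmetric] s_def[symmetric]
      using q2 by (simp add: power2_eq_square)
    have "min 1 (sqrt (T / n)) / n \<le> sqrt (T / n) / n" by (intro divide_right_mono) auto
    also note *
    also have "2 * (sqrt (T / (real n - 1)) - sqrt (T / n)) = tail_majorant T n - tail_majorant T (real n - 1)"
      using 2 n1 T by (auto simp: tail_majorant_def)
    finally show ?thesis .
  next
    case 3
    \<comment> \<open>The unit step is split at \<open>T\<close>: the logarithmic piece covers
      \<open>(T - (n - 1)) / n\<close>, the square-root piece covers \<open>(n - T) / n\<close>, and
      these add up to \<open>1 / n\<close>.\<close>
    have "1 - (real n - 1) / T \<le> ln (T / (real n - 1))"
      using one_minus_inverse_le_ln[of "T / (real n - 1)"] T n1 by simp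
    moreover have "(T - (real n - 1)) / n \<le> 1 - (real n - 1) / T"
    proof -
      have "(T - (real n - 1)) / n \<le> (T - (real n - 1)) / T"
        using 3 T by (intro divide_left_mono) auto
      then show ?thesis using T by (simp add: diff_divide_distrib)
    qed
    moreover have "(real n - T) / n \<le> 2 - 2 * sqrt (T / n)"
    proof -
      have "0 \<le> (1 - sqrt (T / n))\<^sup>2" by simp
      then have "2 * sqrt (T / n) \<le> 1 + T / n" using T by (simp add: power2_diff)
      then show ?thesis using n1 by (simp add: diff_divide_distrib)
    qed
    ultimately have "(T - (real n - 1)) / n + (real n - T) / n \<le> ln (T / (real n - 1)) + 2 - 2 * sqrt (T / n)"
      by linarith
    moreover have "(T - (real n - 1)) / n + (real n - T) / n = 1 / n"
      by (simp add: add_divide_distrib[symmetric])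
    moreover have "min 1 (sqrt (T / n)) / n \<le> 1 / n" by (intro divide_right_mono) auto
    ultimately show ?thesis using 3 T n1 by (simp add: tail_majorant_def ln_div)
  qed
qed

text \<open>The first term is at most \<open>1 / m\<close>; the others telescope, and
  \<open>ln T + 2\<close> bounds the majorant for all \<open>N\<close>, so the estimate is uniform
  in \<open>N\<close>.\<close>

lemma sum_min_sqrt_le:
  fixes T :: real and m N :: nat
  assumes "1 \<le> m" "m \<le> T"
  shows "(\<Sum>n=m..N. min 1 (sqrt (T / n)) / n) \<le> 1 / m + ln (T / m) + 2"
proof (cases "m \<le> N")
  case True
  have "(\<Sum>n=m..N. min 1 (sqrt (T / n)) / n) \<le> 1 / m + (tail_majorant T N - tail_majorant T m)"
    using True
  proof (induction N rule: dec_induct)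
    case base
    show ?case by (simp add: divide_right_mono)
  next
    case (step N)
    have "min 1 (sqrt (T / Suc N)) / Suc N \<le> tail_majorant T (Suc N) - tail_majorant T N"
      using tail_majorant_step[of T "Suc N"] assms step by simp
    then show ?case using step by (simp add: sum.atLeast_Suc_atMost)
  qed
  moreover have "tail_majorant T N \<le> ln T + 2"
  proof (cases "N \<le> T")
    case True
    then have "ln (real N) \<le> ln T" using assms \<open>m \<le> N\<close> by simp
    then show ?thesis using True by (simp add: tail_majorant_def)
  qed (use assms in \<open>auto simp: tail_majorant_def\<close>)
  moreover have "tail_majorant T m = ln m" using assms by (simp add: tail_majorant_def)
  ultimately show ?thesis using assms by (simp add: ln_div)
next
  case False
  have "0 \<le> ln (T / m)" using assms by simp
  then show ?thesis using False by simp
qed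

section \<open>Counting the jumps of the kernel\<close>

text \<open>An integer \<open>n\<close> in \<open>(a/y, a'/y]\<close> is one with \<open>y\<close>
  in \<open>(a/n, a'/n]\<close>. Here \<open>y \<le> 1\<close> forces \<open>n > a\<close>, hence
  \<open>n \<ge> m\<close>, and \<open>y \<ge> \<epsilon>\<close> forces \<open>n \<le> L\<close>,
  which keeps the sum finite.\<close>

lemma floor_diff_le_sum_indicator:
  fixes a a' y \<epsilon> :: real and m L :: nat
  assumes "0 < a" "a < a'" "0 < \<epsilon>" "\<epsilon> \<le> y" "y \<le> 1"
    and "m = nat \<lfloor>a\<rfloor> + 1" "a' / \<epsilon> \<le> L"
  shows "of_int (\<lfloor>a'/y\<rfloor> - \<lfloor>a/y\<rfloor>) \<le> (\<Sum>n=m..L. indicat_real {a/n<..a'/n} y)"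
proof -
  have y: "y > 0" using assms by simp
  have fl: "0 \<le> \<lfloor>a/y\<rfloor>" "\<lfloor>a/y\<rfloor> \<le> \<lfloor>a'/y\<rfloor>"
    using assms y by (auto intro!: floor_mono divide_right_mono)
  have sub: "{nat \<lfloor>a/y\<rfloor> + 1..nat \<lfloor>a'/y\<rfloor>} \<subseteq> {n\<in>{m..L}. y \<in> {a/n<..a'/n}}"
  proof
    fix n assume n: "n \<in> {nat \<lfloor>a/y\<rfloor> + 1..nat \<lfloor>a'/y\<rfloor>}"
    then have "\<lfloor>a/y\<rfloor> < int n" "int n \<le> \<lfloor>a'/y\<rfloor>" and n0: "n > 0" using fl by auto
    then have 1: "a / y < n" "n \<le> a' / y"
      by (auto simp: floor_less_iff le_floor_iff)
    then have 2: "a / n < y" "y \<le> a' / n" using y n0 by (auto simp: field_simps)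
    have "a \<le> a / y" using assms y by (simp add: field_simps mult_left_le)
    then have "m \<le> n" using 1 assms by (simp add: Suc_le_eq nat_less_iff floor_less_iff)
    moreover have "a' / y \<le> a' / \<epsilon>" using assms y by (intro divide_left_mono) auto
    then have "n \<le> L" using 1 assms by linarith
    ultimately show "n \<in> {n\<in>{m..L}. y \<in> {a/n<..a'/n}}" using 2 by auto
  qed
  have "of_int (\<lfloor>a'/y\<rfloor> - \<lfloor>a/y\<rfloor>) = real (card {nat \<lfloor>a/y\<rfloor> + 1..nat \<lfloor>a'/y\<rfloor>})"
    using fl by (simp add: of_nat_diff nat_mono of_nat_nat[OF order_trans[OF fl]])
  also have "\<dots> \<le> real (card {n\<in>{m..L}. y \<in> {a/n<..a'/n}})"
    by (intro of_nat_mono card_mono sub) auto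
  also have "\<dots> = (\<Sum>n=m..L. indicat_real {a/n<..a'/n} y)"
    by (simp add: indicator_def sum.If_cases Int_def)
  finally show ?thesis .
qed

section \<open>Bounds for eigenfunctions\<close>

locale normalized_eigenfunction =
  fixes phi :: "real \<Rightarrow> real" and lam :: real
  assumes L2: "phi \<in> L2_01"
    and normalized: "inner01 phi phi = 1"
    and eigen: "\<And>x. x \<in> {0..1} \<Longrightarrow> phi x = lam * (LINT y:{0..1}|lebesgue. K x y * phi y)"
begin

lemma phi_measurable [measurable]: "phi \<in> borel_measurable unit_measure"
  using L2 by (simp add: L2_01_def set_borel_measurable_def borel_measurable_restrict_space_iff)

lemma integrable_phi_square: "integrable unit_measure (\<lambda>y. (phi y)\<^sup>2)"
  using L2 by (simp add: L2_01_def set_integrable_eq)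

lemma integral_phi_square: "(LINT y|unit_measure. (phi y)\<^sup>2) = 1"
  using normalized by (simp add: inner01_def set_integral_unit power2_eq_square)

lemma phi_eq: "x \<in> {0..1} \<Longrightarrow> phi x = lam * (LINT y|unit_measure. K x y * phi y)"
  using eigen[of x] by (simp add: set_integral_unit)

text \<open>The kernel is at most 1/2 and \<open>phi\<close> has norm 1; Cauchy-Schwarz against the
  constant 1 appears as the pointwise inequality
  \<open>2 * \<bar>phi y\<bar> \<le> 1 + (phi y)\<^sup>2\<close>.\<close>

lemma abs_phi_le:
  assumes "x \<in> {0..1}"
  shows "\<bar>phi x\<bar> \<le> \<bar>lam\<bar> / 2"
proof -
  have int: "integrable unit_measure (\<lambda>y. (1 + (phi y)\<^sup>2) / 4)"
    using integrable_phi_square finite_measure.integrable_const[OF finite_unit_measure] by auto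
  have bd: "\<bar>K x y * phi y\<bar> \<le> (1 + (phi y)\<^sup>2) / 4" for y
  proof -
    have "\<bar>K x y * phi y\<bar> \<le> 1/2 * \<bar>phi y\<bar>"
      unfolding abs_mult by (intro mult_right_mono abs_K_le) auto
    also have "\<dots> \<le> (1 + (phi y)\<^sup>2) / 4"
      using zero_le_power2[of "\<bar>phi y\<bar> - 1"] by (simp add: power2_diff)
    finally show ?thesis .
  qed
  have "integrable unit_measure (\<lambda>y. K x y * phi y)"
    by (rule Bochner_Integration.integrable_bound[OF int]) (measurable, use bd in \<open>auto intro!: AE_I2\<close>)
  then have "\<bar>LINT y|unit_measure. K x y * phi y\<bar> \<le> (LINT y|unit_measure. (1 + (phi y)\<^sup>2) / 4)"
    by (rule integral_abs_bound_integral[OF _ int bd])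
  also have "\<dots> = 1/2"
    using integrable_phi_square finite_measure.integrable_const[OF finite_unit_measure]
    by (simp add: integral_phi_square measure_unit_measure)
  finally show ?thesis
    using phi_eq[OF assms] mult_left_mono[of _ "1/2" "\<bar>lam\<bar>"] by (fastforce simp: abs_mult)
qed

lemma abs_lam_ge_2: "\<bar>lam\<bar> \<ge> 2"
proof -
  have "\<bar>LINT y|unit_measure. (phi y)\<^sup>2\<bar> \<le> (\<bar>lam\<bar> / 2)\<^sup>2"
    using abs_phi_le by (intro abs_integral_unit_le) (auto simp: abs_le_square_iff[symmetric])
  then have "1\<^sup>2 \<le> (\<bar>lam\<bar> / 2)\<^sup>2" by (simp add: integral_phi_square)
  then show ?thesis by (subst (asm) power2_le_iff_abs_le) auto
qed

text \<open>The eigenvalue equation is inserted into itself and the integrals are exchanged; the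
  double integrand is bounded because \<open>phi\<close> is.\<close>

lemma phi_eq_iterated:
  assumes "x \<in> {0..1}"
  shows "phi x = lam\<^sup>2 * (LINT z|unit_measure. (LINT y|unit_measure. K x y * K y z) * phi z)"
proof -
  interpret finite_measure unit_measure by (rule finite_unit_measure)
  interpret P: pair_sigma_finite unit_measure unit_measure ..
  interpret PF: finite_measure "unit_measure \<Otimes>\<^sub>M unit_measure"
    by (intro finite_measure_pair_measure finite_unit_measure)
  have int: "integrable (unit_measure \<Otimes>\<^sub>M unit_measure) (\<lambda>(y, z). K x y * K y z * phi z)"
  proof (rule PF.integrable_const_bound[of _ "1/4 * (\<bar>lam\<bar> / 2)"])
    show "AE p in unit_measure \<Otimes>\<^sub>M unit_measure. norm (case p of (y, z) \<Rightarrow> K x y * K y z * phi z) \<le> 1/4 * (\<bar>lam\<bar> / 2)"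
    proof (rule AE_I2, safe)
      fix y z assume "(y, z) \<in> space (unit_measure \<Otimes>\<^sub>M unit_measure)"
      then have "z \<in> {0..1}" by (simp add: space_pair_measure)
      then show "norm (K x y * K y z * phi z) \<le> 1/4 * (\<bar>lam\<bar> / 2)"
        unfolding real_norm_def abs_mult[of "K x y * K y z"]
        by (intro mult_mono KK_bounded abs_phi_le) auto
    qed
  qed measurable
  have "phi x = lam * (LINT y|unit_measure. K x y * phi y)" by (rule phi_eq[OF assms])
  also have "(LINT y|unit_measure. K x y * phi y) = (LINT y|unit_measure. lam * (LINT z|unit_measure. K x y * K y z * phi z))"
  proof (rule Bochner_Integration.integral_cong[OF refl])
    fix y assume "y \<in> space unit_measure"
    then show "K x y * phi y = lam * (LINT z|unit_measure. K x y * K y z * phi z)"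
      using phi_eq[of y] by (simp add: mult.assoc)
  qed
  also have "\<dots> = lam * (LINT y|unit_measure. (LINT z|unit_measure. K x y * K y z * phi z))"
    by simp
  also have "(LINT y|unit_measure. (LINT z|unit_measure. K x y * K y z * phi z)) =
      (LINT z|unit_measure. (LINT y|unit_measure. K x y * K y z * phi z))"
    by (rule P.Fubini_integral[OF int, symmetric])
  finally show ?thesis by (simp add: power2_eq_square)
qed

text \<open>Cauchy-Schwarz for the iterated kernel \<open>k\<close>, whose squared norm is at most
  \<open>x / 8\<close>. The constant 9/25 is a rational slightly above
  \<open>1 / sqrt 8\<close>.\<close>

lemma abs_phi_le_sqrt:
  assumes "x \<in> {0..1}"
  shows "\<bar>phi x\<bar> \<le> 9/25 * lam\<^sup>2 * sqrt x"
proof (cases "x = 0")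
  case True
  then show ?thesis using phi_eq[of 0] by (simp add: K_def)
next
  case False
  then have x: "0 < x" "x \<le> 1" using assms by auto
  define k where "k z = (LINT y|unit_measure. K x y * K y z)" for z
  interpret finite_measure unit_measure by (rule finite_unit_measure)
  have meas [measurable]: "k \<in> borel_measurable unit_measure"
    unfolding k_def by measurable
  have k1: "\<bar>k z\<bar> \<le> 1/4" for z
    unfolding k_def by (rule abs_integral_unit_le) (use KK_bounded in auto)
  have intk: "integrable unit_measure (\<lambda>z. (k z)\<^sup>2)"
    by (rule integrable_unit_bounded[of _ "(1/4)\<^sup>2"])
       (measurable, use k1 in \<open>auto simp: abs_le_square_iff[symmetric] simp del: power_divide\<close>)
  \<comment> \<open>The integrand is the square of \<open>min (1/4) (x / (4 * z))\<close>, which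
    dominates \<open>k\<close>.\<close>
  have "((\<lambda>z. if z \<le> x then 1/16 else x\<^sup>2 / (16 * z\<^sup>2)) has_integral (x/16 + (x - x\<^sup>2)/16)) {0..1}"
  proof (rule has_integral_combine[of 0 x 1])
    have "((\<lambda>z. 1/16) has_integral x/16) {0..x}"
      using has_integral_const_real[of "1/16 :: real" 0 x] x by simp
    then show "((\<lambda>z. if z \<le> x then 1/16 else x\<^sup>2 / (16 * z\<^sup>2)) has_integral x/16) {0..x}"
      by (rule has_integral_eq[rotated]) auto
    have "((\<lambda>z. x\<^sup>2 / (16 * z\<^sup>2)) has_integral (- x\<^sup>2/(16*1) - (- x\<^sup>2/(16*x)))) {x..1}"
      by (rule fundamental_theorem_of_calculus)
         (use x in \<open>auto intro!: derivative_eq_intros simp: has_real_derivative_iff_has_vector_derivative[symmetric] power2_eq_square\<close>)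
    moreover have "- x\<^sup>2/(16*1) - (- x\<^sup>2/(16*x)) = (x - x\<^sup>2)/16"
      using x by (simp add: field_simps power2_eq_square)
    ultimately have "((\<lambda>z. x\<^sup>2 / (16 * z\<^sup>2)) has_integral (x - x\<^sup>2)/16) {x..1}" by (simp only:)
    then show "((\<lambda>z. if z \<le> x then 1/16 else x\<^sup>2 / (16 * z\<^sup>2)) has_integral (x - x\<^sup>2)/16) {x..1}"
      by (rule has_integral_spike[of "{x}", rotated 2]) auto
  qed (use x in auto)
  then have "norm (integral {0..1} (\<lambda>z. (k z)\<^sup>2)) \<le> x/16 + (x - x\<^sup>2)/16"
  proof (rule integral_norm_bound_integral'[rotated 3])
    fix z :: real assume z: "z \<in> {0..1}"
    have "(k z)\<^sup>2 \<le> (1/4)\<^sup>2" using k1[of z] by (subst abs_le_square_iff[symmetric]) auto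
    moreover have "(k z)\<^sup>2 \<le> (x / (4 * z))\<^sup>2" if "z > x"
      using abs_integral_KK_le[OF x, of z] z x that
      unfolding k_def by (subst abs_le_square_iff[symmetric]) auto
    ultimately show "norm ((k z)\<^sup>2) \<le> (if z \<le> x then 1/16 else x\<^sup>2 / (16 * z\<^sup>2))"
      by (auto simp: power_divide power_mult_distrib)
  qed auto
  then have k2: "(LINT z|unit_measure. (k z)\<^sup>2) \<le> x / 8"
  proof -
    have "(LINT z|unit_measure. (k z)\<^sup>2) = integral {0..1} (\<lambda>z. (k z)\<^sup>2)"
      by (rule lebesgue_integral_eq_integral[OF intk]) simp
    then show ?thesis
      using \<open>norm _ \<le> _\<close> zero_le_power2[of x] unfolding real_norm_def by argo
  qed
  \<comment> \<open>Weight for the arithmetic-geometric form of Cauchy-Schwarz. The optimum is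
    \<open>sqrt 8 / sqrt x\<close>; 3 replaces \<open>sqrt 8\<close> to keep the constants rational,
    giving 17/48.\<close>
  define t where "t = 3 / sqrt x"
  have t: "t > 0" using x by (simp add: t_def)
  have bd: "\<bar>k z * phi z\<bar> \<le> (t * (k z)\<^sup>2 + (phi z)\<^sup>2 / t) / 2" for z
  proof -
    have "0 \<le> (t * \<bar>k z\<bar> - \<bar>phi z\<bar>)\<^sup>2 / t" using t by simp
    also have "\<dots> = t * (k z)\<^sup>2 + (phi z)\<^sup>2 / t - 2 * \<bar>k z * phi z\<bar>"
      using t by (simp add: power2_diff field_simps power2_eq_square abs_mult)
    finally show ?thesis by simp
  qed
  have int: "integrable unit_measure (\<lambda>z. (t * (k z)\<^sup>2 + (phi z)\<^sup>2 / t) / 2)"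
    using intk integrable_phi_square by auto
  have "integrable unit_measure (\<lambda>z. k z * phi z)"
    by (rule Bochner_Integration.integrable_bound[OF int borel_measurable_times[OF meas phi_measurable]])
       (rule AE_I2, unfold real_norm_def, rule order_trans[OF bd abs_ge_self])
  then have "\<bar>LINT z|unit_measure. k z * phi z\<bar> \<le> (LINT z|unit_measure. (t * (k z)\<^sup>2 + (phi z)\<^sup>2 / t) / 2)"
    by (rule integral_abs_bound_integral[OF _ int bd])
  also have "\<dots> = (t * (LINT z|unit_measure. (k z)\<^sup>2) + 1 / t) / 2"
    using intk integrable_phi_square by (simp add: integral_phi_square)
  also have "\<dots> \<le> (t * (x / 8) + 1 / t) / 2"
    using mult_left_mono[OF k2, of t] t by simp
  also have "\<dots> = 17/48 * sqrt x"
    using x by (simp add: t_def field_simps)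
  also have "\<dots> \<le> 9/25 * sqrt x" using x by simp
  finally have "lam\<^sup>2 * \<bar>LINT z|unit_measure. k z * phi z\<bar> \<le> lam\<^sup>2 * (9/25 * sqrt x)"
    by (intro mult_left_mono) auto
  then show ?thesis
    using phi_eq_iterated[OF assms] by (simp add: k_def abs_mult mult_ac)
qed

text \<open>
  The cases come from \<open>\<bar>\<phi> y\<bar> \<le> 9/25 \<lambda>\<^sup>2 \<surd>y\<close> and from
  \<open>\<bar>\<phi> y\<bar>/y \<le> (\<bar>\<lambda>\<bar> \<phi>(y)\<^sup>2 + 1/(\<bar>\<lambda>\<bar> y\<^sup>2))/2\<close>, respectively.
\<close>

definition sing_majorant :: "real \<Rightarrow> real" where
  "sing_majorant y = (if y \<le> 1 / lam\<^sup>2 then 9/25 * lam\<^sup>2 / sqrt y else 1 / (2 * \<bar>lam\<bar> * y\<^sup>2))"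

lemma sing_majorant_nonneg: "y \<ge> 0 \<Longrightarrow> 0 \<le> sing_majorant y"
  by (simp add: sing_majorant_def)

lemma has_integral_sing_majorant:
  "(sing_majorant has_integral (18/25 * \<bar>lam\<bar> + (\<bar>lam\<bar> / 2 - 1 / (2 * \<bar>lam\<bar>)))) {0..1}"
proof -
  define l where "l = \<bar>lam\<bar>"
  define d where "d = 1 / lam\<^sup>2"
  have l: "l \<ge> 2" using abs_lam_ge_2 by (simp add: l_def)
  have lam2: "lam\<^sup>2 = l\<^sup>2" by (simp add: l_def)
  have sd: "sqrt d = 1 / l" using l by (simp add: d_def lam2 real_sqrt_divide)
  have d: "0 < d" "d < 1"
    using l one_less_power[of l 2] by (auto simp: d_def lam2)
  have "(sing_majorant has_integral (18/25 * l + (l / 2 - 1 / (2 * l)))) {0..1}"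
  proof (rule has_integral_combine[of 0 d 1])
    \<comment> \<open>The integrand blows up at 0, so differentiability of the primitive is used
      only in the interior, with continuity at the endpoints.\<close>
    have "((\<lambda>y. 9/25 * l\<^sup>2 / sqrt y) has_integral (18/25 * l\<^sup>2 * sqrt d - 18/25 * l\<^sup>2 * sqrt 0)) {0..d}"
      by (rule fundamental_theorem_of_calculus_interior)
         (use d in \<open>auto intro!: derivative_eq_intros continuous_intros simp: has_real_derivative_iff_has_vector_derivative[symmetric] field_simps\<close>)
    moreover have "18/25 * l\<^sup>2 * sqrt d - 18/25 * l\<^sup>2 * sqrt 0 = 18/25 * l"
      using l by (simp add: sd power2_eq_square)
    ultimately have "((\<lambda>y. 9/25 * l\<^sup>2 / sqrt y) has_integral (18/25 * l)) {0..d}"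
      by (simp only:)
    then show "(sing_majorant has_integral (18/25 * l)) {0..d}"
      by (rule has_integral_eq[rotated]) (auto simp: sing_majorant_def d_def lam2)
    have "((\<lambda>y. 1 / (2 * l * y\<^sup>2)) has_integral (- 1 / (2 * l * 1) - (- 1 / (2 * l * d)))) {d..1}"
      by (rule fundamental_theorem_of_calculus)
         (use d l in \<open>auto intro!: derivative_eq_intros simp: has_real_derivative_iff_has_vector_derivative[symmetric] field_simps power2_eq_square\<close>)
    moreover have "- 1 / (2 * l * 1) - (- 1 / (2 * l * d)) = l / 2 - 1 / (2 * l)"
      using l lam2 by (simp add: d_def power2_eq_square)
    ultimately have "((\<lambda>y. 1 / (2 * l * y\<^sup>2)) has_integral (l / 2 - 1 / (2 * l))) {d..1}"
      by (simp only:)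
    then show "(sing_majorant has_integral (l / 2 - 1 / (2 * l))) {d..1}"
      by (rule has_integral_spike[of "{d}", rotated 2]) (auto simp: sing_majorant_def d_def l_def)
  qed (use d in auto)
  then show ?thesis by (simp only: l_def)
qed

lemma integrable_sing_majorant: "integrable unit_measure sing_majorant"
  by (intro absolutely_integrable_imp_integrable nonnegative_absolutely_integrable_1)
     (use has_integral_sing_majorant sing_majorant_nonneg in auto)

lemma integral_sing_majorant_le: "(LINT y|unit_measure. sing_majorant y) \<le> (18/25 + 1/2) * \<bar>lam\<bar>"
proof -
  have "(LINT y|unit_measure. sing_majorant y) = 18/25 * \<bar>lam\<bar> + (\<bar>lam\<bar> / 2 - 1 / (2 * \<bar>lam\<bar>))"
    using lebesgue_integral_eq_integral[OF integrable_sing_majorant]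
      integral_unique[OF has_integral_sing_majorant] by simp
  moreover have "0 \<le> 1 / (2 * \<bar>lam\<bar>)" by simp
  ultimately show ?thesis by argo
qed

lemma abs_phi_divide_le:
  assumes "0 < y" "y \<le> 1"
  shows "\<bar>phi y\<bar> / y \<le> \<bar>lam\<bar> / 2 * (phi y)\<^sup>2 + sing_majorant y"
proof (cases "y \<le> 1 / lam\<^sup>2")
  case True
  have "\<bar>phi y\<bar> / y \<le> (9/25 * lam\<^sup>2 * sqrt y) / y"
    using abs_phi_le_sqrt[of y] assms by (intro divide_right_mono) auto
  also have "\<dots> = 9/25 * lam\<^sup>2 / sqrt y"
    using assms by (simp add: field_simps)
  finally show ?thesis using True by (simp add: sing_majorant_def add_increasing)
next
  case False
  have l: "\<bar>lam\<bar> > 0" using abs_lam_ge_2 by simp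
  have "0 \<le> (\<bar>lam\<bar> * \<bar>phi y\<bar> - 1 / y)\<^sup>2 / (2 * \<bar>lam\<bar>)" using l by simp
  also have "\<dots> = \<bar>lam\<bar> / 2 * (phi y)\<^sup>2 + 1 / (2 * \<bar>lam\<bar> * y\<^sup>2) - \<bar>phi y\<bar> / y"
    using l assms by (simp add: power2_diff power_mult_distrib field_simps power2_eq_square)
  finally show ?thesis using False by (simp add: sing_majorant_def)
qed

section \<open>Difference quotients of an eigenfunction\<close>

text \<open>\<open>T\<close> is chosen so that \<open>9/25 * lam\<^sup>2 * sqrt (a'/n)\<close>
  equals \<open>\<bar>lam\<bar>/2 * sqrt (T/n)\<close>; both bounds on \<open>phi\<close> then merge
  into one minimum. The constant 43/25 is 1/2 + 18/25 + 1/2.\<close>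

lemma phi_diff_le_cutoff:
  fixes x x' a a' T \<epsilon> :: real and m L :: nat
  defines "a \<equiv> 1 / x" and "a' \<equiv> 1 / x'"
  defines "T \<equiv> (18/25 * lam)\<^sup>2 * a'"
  assumes x: "0 < x'" "x' < x" "x \<le> 1"
    and m: "m = nat \<lfloor>a\<rfloor> + 1" and L: "a' / \<epsilon> \<le> L" and \<epsilon>: "\<epsilon> > 0"
  shows "\<bar>LINT y|unit_measure. (K x y - K x' y) * phi y\<bar> \<le>
    \<bar>lam\<bar> / 2 * \<epsilon> + (a' - a) * (43/25 * \<bar>lam\<bar>)
      + (a' - a) * (\<bar>lam\<bar> / 2) * (\<Sum>n=m..L. min 1 (sqrt (T / n)) / n)"
proof -
  \<comment> \<open>\<open>c n\<close> bounds \<open>phi\<close> on \<open>A n\<close>, the set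
    where the jump numbered \<open>n\<close> is counted. In the dominating function
    \<open>g\<close>, the strip \<open>y \<le> \<epsilon>\<close> gets a trivial bound, so that
    finitely many jumps remain.\<close>
  define c where "c n = \<bar>lam\<bar> / 2 * min 1 (sqrt (T / real n))" for n :: nat
  define A where "A n = {a / real n<..a' / real n}" for n :: nat
  define g where "g y = \<bar>lam\<bar> / 2 * indicat_real {0..\<epsilon>} y
    + (a' - a) * (\<bar>lam\<bar> / 2 * (phi y)\<^sup>2 + sing_majorant y)
    + (\<Sum>n=m..L. c n * indicat_real (A n) y)" for y
  have a: "1 \<le> a" "a < a'" using x by (auto simp: a_def a'_def field_simps)
  have T0: "T \<ge> 0" using a by (simp add: T_def)
  have c0: "c n \<ge> 0" for n using T0 by (simp add: c_def)
  interpret finite_measure unit_measure by (rule finite_unit_measure)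
  have ind_int: "integrable unit_measure (indicat_real {u..v})" "integrable unit_measure (indicat_real {u<..v})" for u v
    by (rule integrable_unit_bounded[of _ 1]; (measurable | simp add: indicator_def))+
  have ind_le: "(LINT y|unit_measure. indicat_real {u..v} y) \<le> v - u"
    "(LINT y|unit_measure. indicat_real {u<..v} y) \<le> v - u" if "u \<le> v" for u v
  proof -
    have *: "(LINT y|unit_measure. indicat_real B y) \<le> v - u" if B: "B \<in> sets borel" "B \<subseteq> {u..v}" for B
    proof -
      have "(LINT y|unit_measure. indicat_real B y) = measure lebesgue (B \<inter> {0..1})"
        using B by (simp add: measure_restrict_space Int_commute)
      also have "\<dots> \<le> measure lebesgue {u..v}"
        using B by (intro measure_mono_fmeasurable) auto
      finally show ?thesis using \<open>u \<le> v\<close> by simp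
    qed
    show "(LINT y|unit_measure. indicat_real {u..v} y) \<le> v - u"
      "(LINT y|unit_measure. indicat_real {u<..v} y) \<le> v - u" by (rule *; auto)+
  qed
  have int_g: "integrable unit_measure g"
    unfolding g_def A_def
    by (intro Bochner_Integration.integrable_add Bochner_Integration.integrable_sum integrable_mult_right
        ind_int integrable_phi_square integrable_sing_majorant)
  have bd: "\<bar>(K x y - K x' y) * phi y\<bar> \<le> g y" if y: "y \<in> {0..1}" for y
  proof (cases "y \<le> \<epsilon>")
    case True
    have "\<bar>(K x y - K x' y) * phi y\<bar> \<le> 1 * (\<bar>lam\<bar> / 2)"
      unfolding abs_mult using abs_phi_le[OF y] abs_K_le[of x y] abs_K_le[of x' y]
      by (intro mult_mono) auto
    also have "\<dots> \<le> g y"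
      unfolding g_def using True y a c0 sing_majorant_nonneg[of y]
      by (simp add: add.assoc) (intro add_nonneg_nonneg mult_nonneg_nonneg sum_nonneg; simp)
    finally show ?thesis .
  next
    case False
    then have y0: "0 < y" "\<epsilon> < y" "y \<le> 1" using \<epsilon> y by auto
    define N where "N = \<lfloor>a'/y\<rfloor> - \<lfloor>a/y\<rfloor>"
    have N0: "N \<ge> 0" unfolding N_def using a y0 by (auto intro!: floor_mono divide_right_mono)
    have "K x y - K x' y = (a' - a) / y - of_int N"
      using x y0 by (simp add: K_def frac_def N_def a_def a'_def diff_divide_distrib mult.commute)
    then have "\<bar>K x y - K x' y\<bar> \<le> (a' - a) / y + of_int N"
      using N0 a y0 by (auto intro!: order_trans[OF abs_triangle_ineq4])
    then have "\<bar>(K x y - K x' y) * phi y\<bar> \<le> ((a' - a) / y + of_int N) * \<bar>phi y\<bar>"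
      unfolding abs_mult by (intro mult_right_mono) auto
    also have "\<dots> = (a' - a) * (\<bar>phi y\<bar> / y) + of_int N * \<bar>phi y\<bar>"
      by (simp add: algebra_simps)
    also have "\<dots> \<le> (a' - a) * (\<bar>lam\<bar> / 2 * (phi y)\<^sup>2 + sing_majorant y) + (\<Sum>n=m..L. c n * indicat_real (A n) y)"
    proof (intro add_mono mult_left_mono abs_phi_divide_le)
      have "of_int N \<le> (\<Sum>n=m..L. indicat_real (A n) y)"
        unfolding N_def A_def
        by (rule floor_diff_le_sum_indicator[of a a' \<epsilon>]) (use a y0 \<epsilon> m L in auto)
      then have "of_int N * \<bar>phi y\<bar> \<le> (\<Sum>n=m..L. indicat_real (A n) y) * \<bar>phi y\<bar>"
        by (intro mult_right_mono) auto
      also have "\<dots> = (\<Sum>n=m..L. \<bar>phi y\<bar> * indicat_real (A n) y)"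
        unfolding sum_distrib_right by (simp only: mult.commute)
      also have "\<dots> \<le> (\<Sum>n=m..L. c n * indicat_real (A n) y)"
      proof (rule sum_mono)
        fix n assume n: "n \<in> {m..L}"
        show "\<bar>phi y\<bar> * indicat_real (A n) y \<le> c n * indicat_real (A n) y"
        proof (cases "y \<in> A n")
          case True
          then have "y \<le> a' / n" by (simp add: A_def)
          have "\<bar>phi y\<bar> \<le> 9/25 * lam\<^sup>2 * sqrt y" by (rule abs_phi_le_sqrt[OF y])
          also have "\<dots> \<le> 9/25 * lam\<^sup>2 * sqrt (a' / n)"
            using \<open>y \<le> a' / n\<close> by (intro mult_left_mono) auto
          also have "\<dots> = \<bar>lam\<bar> / 2 * sqrt (T / n)"
            by (simp add: T_def real_sqrt_mult real_sqrt_divide power2_eq_square abs_mult)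
          finally have "\<bar>phi y\<bar> \<le> c n"
            using abs_phi_le[OF y] by (simp add: c_def min_def)
          then show ?thesis using True by simp
        qed simp
      qed
      finally show "of_int N * \<bar>phi y\<bar> \<le> (\<Sum>n=m..L. c n * indicat_real (A n) y)" .
    qed (use a y0 in auto)
    finally show ?thesis using False by (simp add: g_def)
  qed
  have "integrable unit_measure (\<lambda>y. (K x y - K x' y) * phi y)"
    by (rule Bochner_Integration.integrable_bound[OF int_g])
       (measurable, use bd in \<open>auto intro!: AE_I2 order_trans[OF bd]\<close>)
  then have "\<bar>LINT y|unit_measure. (K x y - K x' y) * phi y\<bar> \<le> (LINT y|unit_measure. g y)"
    by (rule integral_abs_bound_integral[OF _ int_g bd]) simp
  also have "\<dots> = \<bar>lam\<bar> / 2 * (LINT y|unit_measure. indicat_real {0..\<epsilon>} y)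
      + (a' - a) * (\<bar>lam\<bar> / 2 + (LINT y|unit_measure. sing_majorant y))
      + (\<Sum>n=m..L. c n * (LINT y|unit_measure. indicat_real (A n) y))"
    unfolding g_def A_def
    using ind_int integrable_phi_square integrable_sing_majorant
    by (simp add: integral_phi_square del: Bochner_Integration.integral_indicator sum_mult_indicator)
  also have "\<dots> \<le> \<bar>lam\<bar> / 2 * \<epsilon> + (a' - a) * (\<bar>lam\<bar> / 2 + (18/25 + 1/2) * \<bar>lam\<bar>)
      + (\<Sum>n=m..L. c n * ((a' - a) / n))"
  proof (intro add_mono mult_left_mono sum_mono order_refl integral_sing_majorant_le)
    show "(LINT y|unit_measure. indicat_real {0..\<epsilon>} y) \<le> \<epsilon>" using ind_le(1)[of 0 \<epsilon>] \<epsilon> by simp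
    show "(LINT y|unit_measure. indicat_real (A n) y) \<le> (a' - a) / n" for n
      using ind_le(2)[of "a / n" "a' / n"] a by (simp add: A_def divide_right_mono diff_divide_distrib)
  qed (use a c0 in auto)
  also have "(\<Sum>n=m..L. c n * ((a' - a) / n)) = (a' - a) * (\<bar>lam\<bar> / 2) * (\<Sum>n=m..L. min 1 (sqrt (T / n)) / n)"
    by (simp add: c_def sum_distrib_left mult_ac)
  finally show ?thesis by (simp add: algebra_simps)
qed

text \<open>Sends the cutoff to 0, the harmonic sum being bounded independently of \<open>L\<close>.
  The hypothesis \<open>near\<close> says \<open>a' \<le> m\<close>, which removes \<open>x\<close>
  from the logarithm: \<open>T / m \<le> lam\<^sup>2\<close>.\<close>

lemma phi_diff_le:
  fixes x x' :: real
  assumes x: "0 < x'" "x' < x" "x \<le> 1" and near: "1 / x' \<le> of_int (\<lfloor>1 / x\<rfloor> + 1)"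
  shows "\<bar>phi x - phi x'\<bar> \<le> (1 / x' - 1 / x) * (lam\<^sup>2 * (297/100 + ln \<bar>lam\<bar>))"
proof -
  define l a a' where "l = \<bar>lam\<bar>" and "a = 1 / x" and "a' = 1 / x'"
  define T where "T = (18/25 * lam)\<^sup>2 * a'"
  define m where "m = nat \<lfloor>a\<rfloor> + 1"
  have a: "1 \<le> a" "a < a'" using x by (auto simp: a_def a'_def field_simps)
  have fl: "\<lfloor>a\<rfloor> \<ge> 1" using a by simp
  then have "real m = of_int (\<lfloor>a\<rfloor> + 1)" "m \<ge> 2" unfolding m_def by linarith+
  then have m: "m \<ge> 2" "a' \<le> m" "m \<le> a + 1"
    using near by (auto simp: a_def a'_def)
  have l: "l \<ge> 2" and lam2: "lam\<^sup>2 = l\<^sup>2" using abs_lam_ge_2 by (auto simp: l_def)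
  have T: "T = 324/625 * l\<^sup>2 * a'" by (simp add: T_def power_mult_distrib lam2 power_divide)
  have l4: "l\<^sup>2 \<ge> 4" using power_mono[OF l, of 2] by simp
  \<comment> \<open>With \<open>\<bar>lam\<bar> \<ge> 2\<close> the factor in \<open>T\<close> is at
    least 1296/625 > 2, so \<open>T \<ge> 2 * a \<ge> a + 1 \<ge> m\<close>.\<close>
  have mT: "m \<le> T"
  proof -
    have "324/625 * 4 * a' \<le> 324/625 * l\<^sup>2 * a'" using l4 a by (intro mult_right_mono) auto
    then show ?thesis using m(3) a unfolding T by linarith
  qed
  have "ln (T / m) \<le> ln (l\<^sup>2)"
  proof (rule ln_mono)
    have "T \<le> l\<^sup>2 * m" unfolding T using m(2) a by (intro mult_mono) auto
    then show "T / m \<le> l\<^sup>2" using m(1) by (simp add: field_simps)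
  qed (use m mT in auto)
  then have lnT: "ln (T / m) \<le> 2 * ln l" using l by (simp add: ln_realpow)
  have minv: "1 / real m \<le> 1 / 2" using m(1) by (intro divide_left_mono) auto
  \<comment> \<open>Collecting terms, 43/25 + (1/2 + 2)/2 = 297/100, with coefficient 1 on
    \<open>ln l\<close>.\<close>
  define R where "R = (a' - a) * (43/25 * l) + (a' - a) * (l / 2) * (1/2 + 2 * ln l + 2)"
  have "\<bar>LINT y|unit_measure. (K x y - K x' y) * phi y\<bar> \<le> R"
  proof (rule field_le_epsilon)
    fix e :: real assume e: "e > 0"
    define \<epsilon> where "\<epsilon> = e / (l / 2)"
    have \<epsilon>: "\<epsilon> > 0" "l / 2 * \<epsilon> = e" using e l by (auto simp: \<epsilon>_def)
    define L where "L = nat \<lceil>a' / \<epsilon>\<rceil>"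
    have L: "a' / \<epsilon> \<le> L" unfolding L_def by linarith
    have "(\<Sum>n=m..L. min 1 (sqrt (T / n)) / n) \<le> 1 / m + ln (T / m) + 2"
      using m(1) by (intro sum_min_sqrt_le mT) auto
    then have "(\<Sum>n=m..L. min 1 (sqrt (T / n)) / n) \<le> 1/2 + 2 * ln l + 2"
      using minv lnT by linarith
    then have "(a' - a) * (l / 2) * (\<Sum>n=m..L. min 1 (sqrt (T / n)) / n) \<le> (a' - a) * (l / 2) * (1/2 + 2 * ln l + 2)"
      using a l by (intro mult_left_mono) auto
    moreover have "\<bar>LINT y|unit_measure. (K x y - K x' y) * phi y\<bar> \<le> l / 2 * \<epsilon> + (a' - a) * (43/25 * l)
        + (a' - a) * (l / 2) * (\<Sum>n=m..L. min 1 (sqrt (T / n)) / n)"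
      using phi_diff_le_cutoff[OF x m_def[unfolded a_def] L[unfolded a'_def] \<epsilon>(1)]
      unfolding T_def a_def a'_def l_def .
    ultimately show "\<bar>LINT y|unit_measure. (K x y - K x' y) * phi y\<bar> \<le> R + e"
      unfolding R_def \<epsilon>(2) by linarith
  qed
  moreover have "phi x - phi x' = lam * (LINT y|unit_measure. (K x y - K x' y) * phi y)"
  proof -
    have "integrable unit_measure (\<lambda>y. K w y * phi y)" for w
    proof (rule integrable_unit_bounded[of _ "1/2 * (\<bar>lam\<bar> / 2)"])
      show "\<bar>K w y * phi y\<bar> \<le> 1/2 * (\<bar>lam\<bar> / 2)" if "y \<in> {0..1}" for y
        unfolding abs_mult using abs_phi_le[OF that] by (intro mult_mono abs_K_le) auto
    qed measurable
    then show ?thesis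
      using phi_eq[of x] phi_eq[of x'] x by (simp add: algebra_simps)
  qed
  ultimately have "\<bar>phi x - phi x'\<bar> \<le> l * R"
    unfolding l_def by (simp add: abs_mult mult_left_mono)
  also have "l * R = (a' - a) * (l\<^sup>2 * (297/100 + ln l))"
    by (simp add: R_def algebra_simps power2_eq_square add_divide_distrib diff_divide_distrib)
  finally show ?thesis unfolding lam2 unfolding l_def a_def a'_def .
qed

text \<open>Divides the increment bound by \<open>x - w\<close> and lets \<open>w\<close> tend to
  \<open>x\<close> from the left, which also covers \<open>x = 1\<close>.\<close>

lemma abs_derivative_le:
  assumes x: "0 < x" "x \<le> 1"
    and D: "(phi has_real_derivative D) (at x within {0..1})"
  shows "\<bar>D\<bar> \<le> lam\<^sup>2 * (297/100 + ln \<bar>lam\<bar>) / x\<^sup>2"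
proof -
  define R where "R = lam\<^sup>2 * (297/100 + ln \<bar>lam\<bar>)"
  have left: "at x within {0<..<x} = at_left x"
    by (rule at_within_nhd[of _ "{0<..}"]) (use x in auto)
  have "(phi has_real_derivative D) (at x within {0<..<x})"
    by (rule has_field_derivative_subset[OF D]) (use x in auto)
  then have lim: "((\<lambda>w. (phi w - phi x) / (w - x)) \<longlongrightarrow> D) (at_left x)"
    by (simp add: has_field_derivative_iff left)
  have inv: "((\<lambda>w. 1 / w) \<longlongrightarrow> 1 / x) (at_left x)"
    using x by (auto intro!: tendsto_eq_intros)
  \<comment> \<open>The inequality is strict even when \<open>1 / x\<close> is an integer, so it
    persists for \<open>1 / w\<close> with \<open>w\<close> slightly below \<open>x\<close>.\<close>
  have "1 / x < of_int (\<lfloor>1 / x\<rfloor> + 1)" by linarith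
  from order_tendstoD(2)[OF inv this]
  have ev: "\<forall>\<^sub>F w in at_left x. 1 / w < of_int (\<lfloor>1 / x\<rfloor> + 1)" .
  have ev': "\<forall>\<^sub>F w in at_left x. w \<in> {0<..<x}"
    using x by (rule_tac eventually_at_left_real) auto
  have "\<forall>\<^sub>F w in at_left x. \<bar>(phi w - phi x) / (w - x)\<bar> \<le> R / (x * w)"
    using ev ev'
  proof eventually_elim
    case (elim w)
    have "\<bar>phi w - phi x\<bar> \<le> (1 / w - 1 / x) * R"
      using phi_diff_le[of w x] elim x by (simp add: R_def abs_minus_commute)
    also have "(1 / w - 1 / x) * R = R / (x * w) * (x - w)"
      using elim x by (simp add: field_simps)
    finally show ?case using elim by (simp add: abs_divide divide_le_eq)
  qed
  moreover have "((\<lambda>w. R / (x * w)) \<longlongrightarrow> R / (x * x)) (at_left x)"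
    using x by (auto intro!: tendsto_eq_intros)
  moreover have "((\<lambda>w. \<bar>(phi w - phi x) / (w - x)\<bar>) \<longlongrightarrow> \<bar>D\<bar>) (at_left x)"
    by (intro tendsto_intros lim)
  ultimately have "\<bar>D\<bar> \<le> R / (x * x)"
    by (intro tendsto_le[of "at_left x"]) auto
  then show ?thesis by (simp add: R_def power2_eq_square)
qed

end

theorem theorem4p6:
  fixes J :: "nat set" and phi :: "nat \<Rightarrow> real \<Rightarrow> real" and lam :: "nat \<Rightarrow> real"
    and j :: nat and x D :: real
  assumes "max_orthonormal_eigensystem J phi lam"
    and "eigen_ordered J lam"
    and "j \<in> J"
    and "0 < x" and "x \<le> 1"
    and "(phi j has_real_derivative D) (at x within {0..1})"
  shows "\<bar>D\<bar> < (3 + ln \<bar>lam j\<bar>) * (lam j)\<^sup>2 / x\<^sup>2"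
proof -
  have "is_eigenfunction (phi j) (lam j)" "inner01 (phi j) (phi j) = 1" "lam j \<noteq> 0"
    using assms(1,3) by (auto simp: max_orthonormal_eigensystem_def)
  then interpret normalized_eigenfunction "phi j" "lam j"
    by unfold_locales (auto simp: is_eigenfunction_def)
  have "\<bar>D\<bar> \<le> (lam j)\<^sup>2 * (297/100 + ln \<bar>lam j\<bar>) / x\<^sup>2"
    using assms(4-6) by (rule abs_derivative_le)
  \<comment> \<open>Strictness comes from 297/100 < 3 together with
    \<open>(lam j)\<^sup>2 > 0\<close>.\<close>
  also have "\<dots> < (3 + ln \<bar>lam j\<bar>) * (lam j)\<^sup>2 / x\<^sup>2"
    using \<open>0 < x\<close> \<open>lam j \<noteq> 0\<close>
    by (intro divide_strict_right_mono) (auto simp: mult.commute intro!: mult_strict_right_mono)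
  finally show ?thesis .
qed

end
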